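(* Let $A,B\in\widehat{\mathbb Q}^{m\times n}$ and $s=\min\{m,n\}$. If $A-B$ is appreciable, then $$\|\sigma(A)-\sigma(B)\|_2\le\|A-B\|_F,$$ where $\sigma(A)=(\sigma_1(A),\ldots,\sigma_s(A))^\top$ and $\sigma(B)=(\sigma_1(B),\ldots,\sigma_s(B))^\top$, with $\sigma_1(A)\ge\cdots\ge\sigma_s(A)$ and $\sigma_1(B)\ge\cdots\ge\sigma_s(B)$ being the singular values of $A$ and $B$, respectively, and $\le$ is the total order on dual numbers.
   Context: Dual numbers: $\widehat{\mathbb R}=\{q_{\sf st}+q_{\sf in}\epsilon: q_{\sf st},q_{\sf in}\in\mathbb R\}$ with $\epsilon\neq 0$, $\epsilon^2=0$, is a commutative ring, totally ordered by: $q<p$ iff $q_{\sf st}<p_{\sf st}$, or $q_{\sf st}=p_{\sf st}$ and $q_{\sf in}<p_{\sf in}$. For a positive appreciable dual number $q$ (i.e. $q_{\sf st}>0$), $\sqrt q=\sqrt{q_{\sf st}}+\frac{q_{\sf in}}{2\sqrt{q_{\sf st}}}\epsilon$; also $\sqrt 0=0$. Dual quaternions: let $\mathbb Q$ be the real quaternions. $\widehat{\mathbb Q}=\{q_{\sf st}+q_{\sf in}\epsilon: q_{\sf st},q_{\sf in}\in\mathbb Q\}$, where $\epsilon$ commutes with quaternions and $\epsilon^2=0$. The conjugate is $\bar q=\bar q_{\sf st}+\bar q_{\sf in}\epsilon$. The magnitude of $q$ is the dual number $|q|=|q_{\sf st}|+\frac{q_{\sf st}\bar q_{\sf in}+q_{\sf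 in}\bar q_{\sf st}}{2|q_{\sf st}|}\epsilon$ if $q_{\sf st}\ne0$, and $|q|=|q_{\sf in}|\epsilon$ otherwise. Matrices: $A=(a_{ij})\in\widehat{\mathbb Q}^{m\times n}$ is written $A=A_{\sf st}+A_{\sf in}\epsilon$ with $A_{\sf st},A_{\sf in}\in\mathbb Q^{m\times n}$; $A$ is appreciable if $A_{\sf st}\ne O$ and infinitesimal otherwise (likewise for scalars and vectors). $A^*=(\bar a_{ji})$. A square matrix $U$ is unitary if $U^*U=UU^*=I$. The Frobenius norm is the dual number $\|A\|_F=\sqrt{\sum_{i,j}|a_{ij}|^2}$ if $A_{\sf st}\neq O$, and $\|A\|_F=\|A_{\sf in}\|_F\,\epsilon$ otherwise, where $\|A_{\sf in}\|_F$ is the usual Frobenius norm of a quaternion matrix. For a vector $\mathbf x$ (with dual quaternion, in particular dual number, entries), $\|\mathbf x\|_2$ is its Frobenius norm as a one-column matrix. Singular values: it is known that for every $A\in\widehat{\mathbb Q}^{m\times n}$ there are unitary $U\in\widehat{\mathbb Q}^{m\times m}$, $V\in\widehat{\mathbb Q}^{n\times n}$ such that $A=U\Sigma V^*$, where $\Sigma$ is the $m\times n$ diagonal matrix with diagonal entries $\sigma_1(A)\ge\cdots\ge\sigma_s(A)\ge0$ in $\widehat{\mathbb R}$, $s=\min\{m,n\}$ (first positive appreciable ones, then positive infinitesimal ones, then possibly zeros), and these entries are uniquely determined by $A$ (with multiplicity). They are the singular values of $A$. *)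

theory Defs
  imports "HOL-Analysis.Inner_Product" "Jordan_Normal_Form.Matrix"
begin

section \<open>Real quaternions\<close>

datatype quat = Quat (Qre: real) (Qi: real) (Qj: real) (Qk: real)

lemma quat_eq_iff:
  "p = q \<longleftrightarrow> Qre p = Qre q \<and> Qi p = Qi q \<and> Qj p = Qj q \<and> Qk p = Qk q"
  by (cases p; cases q) simp

instantiation quat :: ring_1
begin

definition "0 = Quat 0 0 0 0"
definition "1 = Quat 1 0 0 0"
definition "p + q = Quat (Qre p + Qre q) (Qi p + Qi q) (Qj p + Qj q) (Qk p + Qk q)"
definition "p - q = Quat (Qre p - Qre q) (Qi p - Qi q) (Qj p - Qj q) (Qk p - Qk q)"
definition "- q = Quat (- Qre q) (- Qi q) (- Qj q) (- Qk q)"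
definition "p * q = Quat
  (Qre p * Qre q - Qi p * Qi q - Qj p * Qj q - Qk p * Qk q)
  (Qre p * Qi q + Qi p * Qre q + Qj p * Qk q - Qk p * Qj q)
  (Qre p * Qj q - Qi p * Qk q + Qj p * Qre q + Qk p * Qi q)
  (Qre p * Qk q + Qi p * Qj q - Qj p * Qi q + Qk p * Qre q)"

instance
  by standard
    (simp_all add: quat_eq_iff zero_quat_def one_quat_def plus_quat_def minus_quat_def
      uminus_quat_def times_quat_def algebra_simps)

end

instantiation quat :: real_algebra_1
begin

definition "r *\<^sub>R q = Quat (r * Qre q) (r * Qi q) (r * Qj q) (r * Qk q)"

instance
  by standard
    (simp_all add: quat_eq_iff scaleR_quat_def plus_quat_def times_quat_def algebra_simps)

end

definition quat_cnj :: "quat \<Rightarrow> quat" where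
  "quat_cnj q = Quat (Qre q) (- Qi q) (- Qj q) (- Qk q)"

instantiation quat :: real_inner
begin

definition inner_quat :: "quat \<Rightarrow> quat \<Rightarrow> real" where
  "inner_quat p q = Qre p * Qre q + Qi p * Qi q + Qj p * Qj q + Qk p * Qk q"
definition norm_quat :: "quat \<Rightarrow> real" where
  "norm_quat q = sqrt ((Qre q)\<^sup>2 + (Qi q)\<^sup>2 + (Qj q)\<^sup>2 + (Qk q)\<^sup>2)"
definition sgn_quat :: "quat \<Rightarrow> quat" where
  "sgn_quat q = q /\<^sub>R norm q"
definition dist_quat :: "quat \<Rightarrow> quat \<Rightarrow> real" where
  "dist_quat p q = norm (p - q)"
definition uniformity_quat :: "(quat \<times> quat) filter" where
  "uniformity_quat = (INF e\<in>{0 <..}. principal {(x, y). dist x y < e})"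
definition open_quat :: "quat set \<Rightarrow> bool" where
  "open_quat U \<longleftrightarrow> (\<forall>x\<in>U. eventually (\<lambda>(x', y). x' = x \<longrightarrow> y \<in> U) uniformity)"

instance
proof
  fix p q r :: quat and a :: real
  show "dist p q = norm (p - q)" by (rule dist_quat_def)
  show "sgn q = q /\<^sub>R norm q" by (rule sgn_quat_def)
  show "uniformity = (INF e\<in>{0 <..}. principal {(x :: quat, y). dist x y < e})"
    by (rule uniformity_quat_def)
  show "open U \<longleftrightarrow> (\<forall>x\<in>U. \<forall>\<^sub>F (x', y) in uniformity. x' = x \<longrightarrow> y \<in> U)" for U :: "quat set"
    by (rule open_quat_def)
  show "inner p q = inner q p" by (simp add: inner_quat_def mult.commute)
  show "inner (p + q) r = inner p r + inner q r"
    by (simp add: inner_quat_def plus_quat_def algebra_simps)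
  show "inner (a *\<^sub>R p) q = a * inner p q"
    by (simp add: inner_quat_def scaleR_quat_def algebra_simps)
  show "0 \<le> inner p p" by (simp add: inner_quat_def)
  show "inner p p = 0 \<longleftrightarrow> p = 0"
    by (auto simp: inner_quat_def quat_eq_iff zero_quat_def add_nonneg_eq_0_iff)
  show "norm p = sqrt (inner p p)" by (simp add: norm_quat_def inner_quat_def power2_eq_square)
qed

end

section \<open>Dual numbers over a ring\<close>

text \<open>
  \<open>Dual a b\<close> is a + b eps, where eps is central and squares to zero. Dual numbers are
  \<open>real dual_num\<close> and dual quaternions are \<open>quat dual_num\<close>.
\<close>

datatype 'a dual_num = Dual (st_part: 'a) (in_part: 'a)

lemma dual_num_eq_iff: "p = q \<longleftrightarrow> st_part p = st_part q \<and> in_part p = in_part q"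
  by (cases p; cases q) simp

instantiation dual_num :: (ring_1) ring_1
begin

definition "0 = Dual 0 0"
definition "1 = Dual 1 0"
definition "p + q = Dual (st_part p + st_part q) (in_part p + in_part q)"
definition "p - q = Dual (st_part p - st_part q) (in_part p - in_part q)"
definition "- q = Dual (- st_part q) (- in_part q)"
definition "p * q = Dual (st_part p * st_part q) (st_part p * in_part q + in_part p * st_part q)"

instance
  by standard
    (simp_all add: dual_num_eq_iff zero_dual_num_def one_dual_num_def plus_dual_num_def
      minus_dual_num_def uminus_dual_num_def times_dual_num_def algebra_simps)

end

instance dual_num :: (comm_ring_1) comm_ring_1
  by standard (simp_all add: dual_num_eq_iff one_dual_num_def plus_dual_num_def times_dual_num_def
      algebra_simps)

instantiation dual_num :: (linorder) linorder
begin

definition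
  "p < (q :: 'a dual_num) \<longleftrightarrow> st_part p < st_part q \<or> st_part p = st_part q \<and> in_part p < in_part q"
definition
  "p \<le> (q :: 'a dual_num) \<longleftrightarrow> p < q \<or> p = q"

instance
  by standard (auto simp: less_dual_num_def less_eq_dual_num_def dual_num_eq_iff)

end

text \<open>
  The square root is meaningful for positive appreciable dual numbers and for 0; it is 0
  on all other arguments.
\<close>

definition dual_sqrt :: "real dual_num \<Rightarrow> real dual_num" where
  "dual_sqrt q =
     (if st_part q > 0 then Dual (sqrt (st_part q)) (in_part q / (2 * sqrt (st_part q))) else 0)"

section \<open>Dual quaternions\<close>

definition dq_of_dual :: "real dual_num \<Rightarrow> quat dual_num" where
  "dq_of_dual q = Dual (of_real (st_part q)) (of_real (in_part q))"

definition dq_cnj :: "quat dual_num \<Rightarrow> quat dual_num" where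
  "dq_cnj q = Dual (quat_cnj (st_part q)) (quat_cnj (in_part q))"

text \<open>
  In the appreciable case the numerator of the infinitesimal part of the magnitude is a
  quaternion whose imaginary components vanish; \<open>Qre\<close> turns it into a real number.
\<close>

definition dq_abs :: "quat dual_num \<Rightarrow> real dual_num" where
  "dq_abs q =
     (if st_part q \<noteq> 0
      then Dual (norm (st_part q))
        (Qre (st_part q * quat_cnj (in_part q) + in_part q * quat_cnj (st_part q))
          / (2 * norm (st_part q)))
      else Dual 0 (norm (in_part q)))"

lemma dq_abs_numerator_real:
  "p * quat_cnj q + q * quat_cnj p = of_real (Qre (p * quat_cnj q + q * quat_cnj p))"
  by (simp add: quat_eq_iff of_real_def scaleR_quat_def one_quat_def plus_quat_def
      times_quat_def quat_cnj_def algebra_simps)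

section \<open>Dual quaternion matrices\<close>

type_synonym dq_mat = "quat dual_num mat"
type_synonym dual_vec = "real dual_num vec"

definition mat_appreciable :: "dq_mat \<Rightarrow> bool" where
  "mat_appreciable A \<longleftrightarrow> map_mat st_part A \<noteq> 0\<^sub>m (dim_row A) (dim_col A)"

definition mat_star :: "dq_mat \<Rightarrow> dq_mat" where
  "mat_star A = map_mat dq_cnj (transpose_mat A)"

definition mat_unitary :: "nat \<Rightarrow> dq_mat \<Rightarrow> bool" where
  "mat_unitary n U \<longleftrightarrow>
     U \<in> carrier_mat n n \<and> mat_star U * U = 1\<^sub>m n \<and> U * mat_star U = 1\<^sub>m n"

definition quat_frob_norm :: "quat mat \<Rightarrow> real" where
  "quat_frob_norm A = sqrt (\<Sum>i<dim_row A. \<Sum>j<dim_col A. (norm (A $$ (i, j)))\<^sup>2)"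

definition frob_norm :: "dq_mat \<Rightarrow> real dual_num" where
  "frob_norm A =
     (if mat_appreciable A
      then dual_sqrt (\<Sum>i<dim_row A. \<Sum>j<dim_col A. (dq_abs (A $$ (i, j)))\<^sup>2)
      else Dual 0 (quat_frob_norm (map_mat in_part A)))"

definition dual_vec_norm :: "dual_vec \<Rightarrow> real dual_num" where
  "dual_vec_norm x = frob_norm (mat_of_cols (dim_vec x) [map_vec dq_of_dual x])"

definition diag_rect :: "nat \<Rightarrow> nat \<Rightarrow> dual_vec \<Rightarrow> dq_mat" where
  "diag_rect m n x = mat m n (\<lambda>(i, j). if i = j then dq_of_dual (x $ i) else 0)"

text \<open>
  \<open>singular_values A x\<close> says that \<open>x\<close> is the vector of singular values of \<open>A\<close>, listed in
  decreasing order. Such a vector exists and is unique by the singular value decomposition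
  theorem. In the total order on dual numbers, a decreasing nonnegative list has the
  appreciable entries first, then the positive infinitesimal ones, then the zeros.
\<close>

definition singular_values :: "dq_mat \<Rightarrow> dual_vec \<Rightarrow> bool" where
  "singular_values A x \<longleftrightarrow>
     dim_vec x = min (dim_row A) (dim_col A) \<and>
     (\<forall>i j. i \<le> j \<and> j < dim_vec x \<longrightarrow> x $ j \<le> x $ i) \<and>
     (\<forall>i < dim_vec x. 0 \<le> x $ i) \<and>
     (\<exists>U V. mat_unitary (dim_row A) U \<and> mat_unitary (dim_col A) V \<and>
        A = U * diag_rect (dim_row A) (dim_col A) x * mat_star V)"

end

theory Submission
  imports Defs
begin

text \<open>
  The dual numbers form an ordered commutative ring: products of nonnegative elements are
  nonnegative, although there are zero divisors. The classical proof of the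
  Hoffman--Wielandt inequality for singular values, via von Neumann's trace inequality, can be
  arranged so that it uses no more than this, and then it runs over the dual numbers
  directly. Standard and infinitesimal parts have to be separated only to see that the order is
  compatible with multiplication, that \<open>|p|\<^sup>2\<close> is nonnegative for a dual quaternion \<open>p\<close>, and
  that the square root is monotone. In particular, the case in which the inequality between the
  standard parts is an equality needs no separate analysis.

  Let \<open>\<langle>X, Y\<rangle>\<close> be the real part of the trace of \<open>X Y\<^sup>*\<close>, a dual number. It is additive in
  both arguments, symmetric and unitarily invariant, and for an appreciable matrix the squared
  Frobenius norm is \<open>\<langle>X, X\<rangle>\<close>. If \<open>A = U \<Sigma>\<^sub>A V\<^sup>*\<close> and
  \<open>B = W \<Sigma>\<^sub>B Z\<^sup>*\<close>, with singular values \<open>a\<close> and \<open>b\<close>, then \<open>\<langle>A, A\<rangle> = \<Sum> a\<^sub>i a\<^sub>i\<close>,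
  \<open>\<langle>B, B\<rangle> = \<Sum> b\<^sub>i b\<^sub>i\<close>, and everything reduces to \<open>\<langle>A, B\<rangle> \<le> \<Sum> a\<^sub>i b\<^sub>i\<close>
  (\<open>von_neumann_trace_inequality\<close>). With the unitary matrices \<open>P = U\<^sup>* W\<close> and
  \<open>Q = Z\<^sup>* V\<close>, \<open>\<langle>A, B\<rangle>\<close> is the sum of
  \<open>a\<^sub>i b\<^sub>j Re (P\<^sub>i\<^sub>j Q\<^sub>j\<^sub>i)\<close> over all \<open>i, j \<le> min m n\<close>, and
  \<open>2 Re (P\<^sub>i\<^sub>j Q\<^sub>j\<^sub>i) \<le> |P\<^sub>i\<^sub>j|\<^sup>2 + |Q\<^sub>j\<^sub>i|\<^sup>2\<close>.
  The squared magnitudes of the entries of a unitary matrix are nonnegative dual numbers whose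
  row and column sums are 1, so a rearrangement inequality for doubly substochastic weights
  (\<open>sum_substochastic_le\<close>) bounds each of the two resulting sums by \<open>\<Sum> a\<^sub>i b\<^sub>i\<close>.
\<close>

section \<open>Rearrangement in an ordered commutative ring\<close>

text \<open>
  Summation by parts writes both sides as combinations of the partial sums of \<open>c\<close> and \<open>d\<close>
  with the same nonnegative coefficients, namely the successive differences of \<open>a\<close> and its
  last value.
\<close>

lemma sum_mult_antitone_mono:
  fixes a c d :: "nat \<Rightarrow> 'a :: ordered_comm_ring"
  assumes anti: "\<And>i j. i \<le> j \<Longrightarrow> j < n \<Longrightarrow> a j \<le> a i"
    and nonneg: "\<And>i. i < n \<Longrightarrow> 0 \<le> a i"
    and partial: "\<And>k. k \<le> n \<Longrightarrow> (\<Sum>i<k. c i) \<le> (\<Sum>i<k. d i)"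
  shows "(\<Sum>i<n. a i * c i) \<le> (\<Sum>i<n. a i * d i)"
proof -
  define e where "e i = d i - c i" for i
  have E: "0 \<le> (\<Sum>i<k. e i)" if "k \<le> n" for k
    using partial[OF that] by (simp add: e_def sum_subtractf)
  have last: "a k * (\<Sum>i<Suc k. e i) \<le> (\<Sum>i<Suc k. a i * e i)" if "k < n" for k
    using that
  proof (induction k)
    case 0
    then show ?case by simp
  next
    case (Suc k)
    have "a (Suc k) * (\<Sum>i<Suc k. e i) \<le> a k * (\<Sum>i<Suc k. e i)"
      using Suc.prems by (intro mult_right_mono anti E) auto
    also have "\<dots> \<le> (\<Sum>i<Suc k. a i * e i)"
      using Suc by simp
    finally show ?case
      by (simp add: distrib_left)
  qed
  have "0 \<le> (\<Sum>i<n. a i * e i)"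
  proof (cases n)
    case (Suc k)
    have "0 \<le> a k * (\<Sum>i<Suc k. e i)"
      using Suc E[of n] nonneg[of k] by (intro mult_nonneg_nonneg) auto
    with last[of k] Suc show ?thesis by (auto intro: order_trans)
  qed simp
  then show ?thesis
    by (simp add: e_def right_diff_distrib sum_subtractf)
qed

text \<open>
  Two summations by parts, one in each index, reduce this to indicator sequences, where it says
  that the entries of the leading \<open>k\<close> by \<open>l\<close> block of \<open>w\<close> add up to at most
  \<open>min k l\<close>.
\<close>

lemma sum_substochastic_le:
  fixes a b :: "nat \<Rightarrow> 'a :: {comm_ring_1, ordered_comm_ring}"
  assumes a: "\<And>i j. i \<le> j \<Longrightarrow> j < n \<Longrightarrow> a j \<le> a i" "\<And>i. i < n \<Longrightarrow> 0 \<le> a i"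
    and b: "\<And>i j. i \<le> j \<Longrightarrow> j < n \<Longrightarrow> b j \<le> b i" "\<And>i. i < n \<Longrightarrow> 0 \<le> b i"
    and w: "\<And>i j. 0 \<le> w i j"
    and row: "\<And>i. i < n \<Longrightarrow> (\<Sum>j<n. w i j) \<le> 1"
    and col: "\<And>j. j < n \<Longrightarrow> (\<Sum>i<n. w i j) \<le> 1"
  shows "(\<Sum>i<n. \<Sum>j<n. a i * b j * w i j) \<le> (\<Sum>i<n. a i * b i)"
proof -
  have block: "(\<Sum>j<l. \<Sum>i<k. w i j) \<le> (\<Sum>j<l. if j < k then 1 else 0)"
    if kl: "k \<le> n" "l \<le> n" for k l
  proof (cases "l \<le> k")
    case True
    have "(\<Sum>i<k. w i j) \<le> (if j < k then 1 else 0)" if "j < l" for j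
    proof -
      have "(\<Sum>i<k. w i j) \<le> (\<Sum>i<n. w i j)"
        using kl w by (intro sum_mono2) auto
      also have "\<dots> \<le> 1"
        using that kl by (intro col) auto
      finally show ?thesis
        using that True by simp
    qed
    then show ?thesis by (intro sum_mono) auto
  next
    case False
    have "(\<Sum>j<l. \<Sum>i<k. w i j) = (\<Sum>i<k. \<Sum>j<l. w i j)"
      by (rule sum.swap)
    also have "\<dots> \<le> (\<Sum>i<k. 1)"
    proof (intro sum_mono)
      fix i assume i: "i \<in> {..<k}"
      have "(\<Sum>j<l. w i j) \<le> (\<Sum>j<n. w i j)"
        using kl w by (intro sum_mono2) auto
      also have "\<dots> \<le> 1"
        using i kl by (intro row) auto
      finally show "(\<Sum>j<l. w i j) \<le> 1" .
    qed
    also have "\<dots> = (\<Sum>j<l. if j < k then 1 else 0)"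
      using False by (intro sum.mono_neutral_cong_left) auto
    finally show ?thesis .
  qed
  have partial: "(\<Sum>i<k. \<Sum>j<n. b j * w i j) \<le> (\<Sum>i<k. b i)" if k: "k \<le> n" for k
  proof -
    have "(\<Sum>i<k. \<Sum>j<n. b j * w i j) = (\<Sum>j<n. b j * (\<Sum>i<k. w i j))"
      by (subst sum.swap) (simp add: sum_distrib_left)
    also have "\<dots> \<le> (\<Sum>j<n. b j * (if j < k then 1 else 0))"
      using b block k by (intro sum_mult_antitone_mono) auto
    also have "\<dots> = (\<Sum>i<k. b i)"
      using k by (intro sum.mono_neutral_cong_right) auto
    finally show ?thesis .
  qed
  have "(\<Sum>i<n. \<Sum>j<n. a i * b j * w i j) = (\<Sum>i<n. a i * (\<Sum>j<n. b j * w i j))"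
    by (simp add: sum_distrib_left mult.assoc)
  also have "\<dots> \<le> (\<Sum>i<n. a i * b i)"
    using a partial by (intro sum_mult_antitone_mono) auto
  finally show ?thesis .
qed

section \<open>Dual numbers as an ordered ring\<close>

lemmas dual_num_defs = zero_dual_num_def one_dual_num_def plus_dual_num_def
  minus_dual_num_def uminus_dual_num_def times_dual_num_def

lemma dual_num_le_iff:
  "p \<le> (q :: 'a :: linorder dual_num) \<longleftrightarrow>
     st_part p < st_part q \<or> st_part p = st_part q \<and> in_part p \<le> in_part q"
  by (auto simp: less_eq_dual_num_def less_dual_num_def dual_num_eq_iff)

text \<open>
  The order is not strictly compatible with multiplication, since \<open>\<epsilon>\<close> is positive and
  squares to zero; the nonstrict laws below are all that the argument needs.
\<close>

instance dual_num :: (linordered_idom) ordered_comm_ring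
proof
  fix p q r :: "'a dual_num"
  show "r + p \<le> r + q" if "p \<le> q"
    using that by (auto simp: dual_num_le_iff dual_num_defs)
  show "r * p \<le> r * q" if "p \<le> q" "0 \<le> r"
    using that by (auto simp: dual_num_le_iff dual_num_defs mult_left_mono mult_right_mono)
qed

lemma st_part_sum: "st_part (sum f I) = (\<Sum>i\<in>I. st_part (f i))"
  by (induction I rule: infinite_finite_induct) (auto simp: dual_num_defs)

lemma dual_sqrt_mono:
  assumes "0 < st_part p" "p \<le> q"
  shows "dual_sqrt p \<le> dual_sqrt q"
  using assms by (auto simp: dual_num_le_iff dual_sqrt_def divide_right_mono)

section \<open>The dual-number-valued inner product of dual quaternions\<close>

text \<open>
  This is the real part of \<open>p\<close> times the conjugate of \<open>q\<close>: the Euclidean inner product of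
  quaternions, extended bilinearly over the dual numbers.
\<close>

definition dq_inner :: "quat dual_num \<Rightarrow> quat dual_num \<Rightarrow> real dual_num" where
  "dq_inner p q = Dual (inner (st_part p) (st_part q))
     (inner (st_part p) (in_part q) + inner (in_part p) (st_part q))"

lemmas quat_defs = zero_quat_def one_quat_def plus_quat_def minus_quat_def
  uminus_quat_def times_quat_def scaleR_quat_def quat_cnj_def inner_quat_def of_real_def

lemma dq_inner_add_left: "dq_inner (p + q) r = dq_inner p r + dq_inner q r"
  by (simp add: dq_inner_def dual_num_defs inner_add_left)

lemma dq_inner_commute: "dq_inner p q = dq_inner q p"
  by (simp add: dq_inner_def inner_commute)

lemma dq_inner_diff_left: "dq_inner (p - q) r = dq_inner p r - dq_inner q r"
  by (simp add: dq_inner_def dual_num_defs inner_diff_left)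

lemma dq_inner_diff_right: "dq_inner r (p - q) = dq_inner r p - dq_inner r q"
  by (simp add: dq_inner_def dual_num_defs inner_diff_right)

lemma dq_inner_zero [simp]: "dq_inner 0 r = 0" "dq_inner r 0 = 0"
  by (simp_all add: dq_inner_def dual_num_defs)

lemma dq_inner_one_one [simp]: "dq_inner 1 1 = 1"
  by (simp add: dq_inner_def dual_num_defs quat_defs)

lemma dq_inner_sum_left: "dq_inner (sum f I) r = (\<Sum>i\<in>I. dq_inner (f i) r)"
  by (induction I rule: infinite_finite_induct) (auto simp: dq_inner_add_left)

lemma dq_inner_sum_right: "dq_inner r (sum f I) = (\<Sum>i\<in>I. dq_inner r (f i))"
  using dq_inner_sum_left[of f I r] by (simp add: dq_inner_commute[of r])

lemma dq_inner_mult_left: "dq_inner (u * p) q = dq_inner p (dq_cnj u * q)"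
  by (simp add: dq_inner_def dq_cnj_def dual_num_defs quat_defs algebra_simps)

lemma dq_inner_mult_right: "dq_inner (p * v) q = dq_inner p (q * dq_cnj v)"
  by (simp add: dq_inner_def dq_cnj_def dual_num_defs quat_defs algebra_simps)

lemma dq_cnj_cnj [simp]: "dq_cnj (dq_cnj p) = p"
  by (simp add: dq_cnj_def quat_cnj_def)

lemma dq_cnj_mult: "dq_cnj (p * q) = dq_cnj q * dq_cnj p"
  by (simp add: dq_cnj_def dual_num_defs quat_defs algebra_simps)

lemma dq_cnj_zero [simp]: "dq_cnj 0 = 0"
  by (simp add: dq_cnj_def dual_num_defs quat_defs)

lemma dq_cnj_add: "dq_cnj (p + q) = dq_cnj p + dq_cnj q"
  by (simp add: dq_cnj_def dual_num_defs quat_defs)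

lemma dq_cnj_sum: "dq_cnj (sum f I) = (\<Sum>i\<in>I. dq_cnj (f i))"
  by (induction I rule: infinite_finite_induct) (auto simp: dq_cnj_add)

lemma dq_inner_cnj_self: "dq_inner (dq_cnj p) (dq_cnj p) = dq_inner p p"
  by (simp add: dq_inner_def dq_cnj_def quat_defs)

lemma dq_of_dual_zero [simp]: "dq_of_dual 0 = 0"
  by (simp add: dq_of_dual_def dual_num_defs)

lemma dq_inner_of_dual: "dq_inner (dq_of_dual a) (dq_of_dual b) = a * b"
  by (simp add: dq_inner_def dq_of_dual_def dual_num_defs quat_defs algebra_simps)

text \<open>Dual numbers are central, so they can be moved out of the real part of a product.\<close>

lemma dq_inner_of_dual_mult:
  "dq_inner (dq_of_dual a) (p * dq_of_dual b * q) = a * b * dq_inner p (dq_cnj q)"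
  by (simp add: dq_inner_def dq_of_dual_def dq_cnj_def dual_num_defs quat_defs algebra_simps)

text \<open>
  A square cannot have a zero standard part and a negative infinitesimal part: if the standard
  part of \<open>p\<close> vanishes, then so does the whole square.
\<close>

lemma dq_inner_self_nonneg: "0 \<le> dq_inner p p"
  by (cases "st_part p = 0")
    (simp_all add: dual_num_le_iff dq_inner_def dual_num_defs)

lemma two_dq_inner_le: "2 * dq_inner p q \<le> dq_inner p p + dq_inner q q"
proof -
  have "0 \<le> dq_inner (p - q) (p - q)"
    by (rule dq_inner_self_nonneg)
  also have "\<dots> = dq_inner p p + dq_inner q q - 2 * dq_inner p q"
    by (simp add: dq_inner_diff_left dq_inner_diff_right dq_inner_commute[of q p])
  finally show ?thesis by simp
qed

text \<open>
  The two cases in the definition of the magnitude agree after squaring: for infinitesimal \<open>q\<close>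
  both sides vanish.
\<close>

lemma dq_abs_power2: "(dq_abs q)\<^sup>2 = dq_inner q q"
proof (cases "st_part q = 0")
  case True
  then show ?thesis
    by (simp add: dq_abs_def dq_inner_def power2_eq_square dual_num_defs)
next
  case False
  have "Qre (x * quat_cnj y + y * quat_cnj x) = 2 * inner x y" for x y
    by (simp add: quat_defs)
  with False show ?thesis
    by (simp add: dq_abs_def dq_inner_def power2_eq_square dual_num_defs inner_commute
        power2_norm_eq_inner[symmetric])
qed

section \<open>The trace inner product of dual quaternion matrices\<close>

definition mat_inner :: "dq_mat \<Rightarrow> dq_mat \<Rightarrow> real dual_num" where
  "mat_inner X Y = (\<Sum>i<dim_row X. \<Sum>j<dim_col X. dq_inner (X $$ (i, j)) (Y $$ (i, j)))"

lemma index_mult_mat_sum: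
  assumes "X \<in> carrier_mat m k" "Y \<in> carrier_mat k n" "i < m" "j < n"
  shows "(X * Y) $$ (i, j) = (\<Sum>l<k. X $$ (i, l) * Y $$ (l, j))"
  using assms by (auto simp: scalar_prod_def atLeast0LessThan)

lemma mult_mat_reassoc:
  assumes "X \<in> carrier_mat m m" "Y \<in> carrier_mat m m" "D \<in> carrier_mat m n"
    "Z \<in> carrier_mat n n" "W \<in> carrier_mat n n"
  shows "X * (Y * D * Z) * W = (X * Y) * D * (Z * W)"
  using assms
  by (simp add: assoc_mult_mat[of _ m m _ m _ n] assoc_mult_mat[of _ m m _ n _ n]
      assoc_mult_mat[of _ m n _ n _ n] mult_carrier_mat[of _ m m _ n] mult_carrier_mat[of _ m n _ n])

lemma mat_star_carrier [simp]: "X \<in> carrier_mat m n \<Longrightarrow> mat_star X \<in> carrier_mat n m"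
  by (simp add: mat_star_def)

lemma mat_star_index:
  "X \<in> carrier_mat m n \<Longrightarrow> i < n \<Longrightarrow> j < m \<Longrightarrow> mat_star X $$ (i, j) = dq_cnj (X $$ (j, i))"
  by (auto simp: mat_star_def)

lemma mat_star_star [simp]: "mat_star (mat_star X) = X"
  by (rule eq_matI) (auto simp: mat_star_def)

lemma mat_star_mult:
  assumes X: "X \<in> carrier_mat m k" and Y: "Y \<in> carrier_mat k n"
  shows "mat_star (X * Y) = mat_star Y * mat_star X"
proof (rule eq_matI)
  fix i j assume "i < dim_row (mat_star Y * mat_star X)" "j < dim_col (mat_star Y * mat_star X)"
  then have ij: "i < n" "j < m"
    using X Y by (auto simp: mat_star_def)
  have "mat_star (X * Y) $$ (i, j) = (\<Sum>l<k. dq_cnj (Y $$ (l, i)) * dq_cnj (X $$ (j, l)))"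
    using X Y ij
    by (simp add: mat_star_index[of _ m n] index_mult_mat_sum[OF X Y] dq_cnj_sum dq_cnj_mult
        del: index_mult_mat)
  also have "\<dots> = (mat_star Y * mat_star X) $$ (i, j)"
    using X Y ij
    by (subst index_mult_mat_sum[of _ n k _ m]) (auto simp: mat_star_index)
  finally show "mat_star (X * Y) $$ (i, j) = (mat_star Y * mat_star X) $$ (i, j)" .
qed (use X Y in \<open>auto simp: mat_star_def\<close>)

lemma mat_inner_commute:
  assumes "X \<in> carrier_mat m n" "Y \<in> carrier_mat m n"
  shows "mat_inner X Y = mat_inner Y X"
  using assms by (auto simp: mat_inner_def dq_inner_commute)

lemma mat_inner_diff_self:
  assumes "X \<in> carrier_mat m n" "Y \<in> carrier_mat m n"
  shows "mat_inner (X - Y) (X - Y) = mat_inner X X + mat_inner Y Y - 2 * mat_inner X Y"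
proof -
  have "dq_inner (p - q) (p - q) = dq_inner p p + dq_inner q q - 2 * dq_inner p q" for p q
    by (simp add: dq_inner_diff_left dq_inner_diff_right dq_inner_commute[of q p])
  then show ?thesis
    using assms by (auto simp: mat_inner_def sum.distrib sum_subtractf sum_distrib_left)
qed

lemma mat_inner_mult_left:
  assumes U: "U \<in> carrier_mat m k" and X: "X \<in> carrier_mat k n" and Y: "Y \<in> carrier_mat m n"
  shows "mat_inner (U * X) Y = mat_inner X (mat_star U * Y)"
proof -
  have "mat_inner (U * X) Y =
      (\<Sum>i<m. \<Sum>j<n. \<Sum>l<k. dq_inner (X $$ (l, j)) (dq_cnj (U $$ (i, l)) * Y $$ (i, j)))"
    using U X unfolding mat_inner_def
    by (auto intro!: sum.cong simp: index_mult_mat_sum[OF U X] dq_inner_sum_left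
        dq_inner_mult_left simp del: index_mult_mat(1))
  also have "\<dots> =
      (\<Sum>l<k. \<Sum>j<n. \<Sum>i<m. dq_inner (X $$ (l, j)) (dq_cnj (U $$ (i, l)) * Y $$ (i, j)))"
    by (subst sum.swap, subst (2) sum.swap, subst sum.swap) (rule refl)
  also have "\<dots> = mat_inner X (mat_star U * Y)"
    using U X Y unfolding mat_inner_def
    by (auto intro!: sum.cong simp: index_mult_mat_sum[of _ k m _ n] dq_inner_sum_right
        mat_star_index simp del: index_mult_mat(1))
  finally show ?thesis .
qed

lemma mat_inner_mult_right:
  assumes X: "X \<in> carrier_mat m k" and V: "V \<in> carrier_mat k n" and Y: "Y \<in> carrier_mat m n"
  shows "mat_inner (X * V) Y = mat_inner X (Y * mat_star V)"
proof -
  have "mat_inner (X * V) Y =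
      (\<Sum>i<m. \<Sum>j<n. \<Sum>l<k. dq_inner (X $$ (i, l)) (Y $$ (i, j) * dq_cnj (V $$ (l, j))))"
    using X V unfolding mat_inner_def
    by (auto intro!: sum.cong simp: index_mult_mat_sum[OF X V] dq_inner_sum_left
        dq_inner_mult_right simp del: index_mult_mat(1))
  also have "\<dots> =
      (\<Sum>i<m. \<Sum>l<k. \<Sum>j<n. dq_inner (X $$ (i, l)) (Y $$ (i, j) * dq_cnj (V $$ (l, j))))"
    by (subst (2) sum.swap) (rule refl)
  also have "\<dots> = mat_inner X (Y * mat_star V)"
    using V X Y unfolding mat_inner_def
    by (auto intro!: sum.cong simp: index_mult_mat_sum[of _ m n _ k] dq_inner_sum_right
        mat_star_index simp del: index_mult_mat(1))
  finally show ?thesis .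
qed

section \<open>Unitary matrices\<close>

lemma mat_unitary_star: "mat_unitary n U \<Longrightarrow> mat_unitary n (mat_star U)"
  by (auto simp: mat_unitary_def)

lemma mat_unitary_mult:
  assumes "mat_unitary n U" "mat_unitary n V"
  shows "mat_unitary n (U * V)"
proof -
  have U: "U \<in> carrier_mat n n" "mat_star U * U = 1\<^sub>m n" "U * mat_star U = 1\<^sub>m n"
    and V: "V \<in> carrier_mat n n" "mat_star V * V = 1\<^sub>m n" "V * mat_star V = 1\<^sub>m n"
    using assms by (auto simp: mat_unitary_def)
  have "mat_star (U * V) * (U * V) = mat_star V * ((mat_star U * U) * V)"
    using U(1) V(1) by (simp add: mat_star_mult[of U n n V n] assoc_mult_mat[of _ n n _ n _ n]
        mult_carrier_mat[of _ n n _ n])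
  moreover have "(U * V) * mat_star (U * V) = U * ((V * mat_star V) * mat_star U)"
    using U(1) V(1) by (simp add: mat_star_mult[of U n n V n] assoc_mult_mat[of _ n n _ n _ n]
        mult_carrier_mat[of _ n n _ n])
  ultimately show ?thesis
    using U V by (simp add: mat_unitary_def left_mult_one_mat[of _ n n])
qed

text \<open>
  Row and column sums are the real parts of the diagonal entries of \<open>U U\<^sup>*\<close> and \<open>U\<^sup>* U\<close>.
\<close>

lemma mat_unitary_row_sum:
  assumes "mat_unitary n U" "i < n"
  shows "(\<Sum>j<n. dq_inner (U $$ (i, j)) (U $$ (i, j))) = 1"
proof -
  have U: "U \<in> carrier_mat n n" "U * mat_star U = 1\<^sub>m n"
    using assms by (auto simp: mat_unitary_def)
  have "(\<Sum>j<n. dq_inner (U $$ (i, j)) (U $$ (i, j))) =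
      dq_inner 1 (\<Sum>j<n. U $$ (i, j) * dq_cnj (U $$ (i, j)))"
    using dq_inner_mult_right[of 1] by (simp add: dq_inner_sum_right)
  also have "(\<Sum>j<n. U $$ (i, j) * dq_cnj (U $$ (i, j))) = (U * mat_star U) $$ (i, i)"
    using U(1) assms(2) by (subst index_mult_mat_sum[of _ n n _ n]) (auto simp: mat_star_index)
  finally show ?thesis
    using assms(2) by (simp add: U(2))
qed

lemma mat_unitary_col_sum:
  assumes "mat_unitary n U" "j < n"
  shows "(\<Sum>i<n. dq_inner (U $$ (i, j)) (U $$ (i, j))) = 1"
proof -
  have "U \<in> carrier_mat n n"
    using assms by (simp add: mat_unitary_def)
  then have "(\<Sum>i<n. dq_inner (U $$ (i, j)) (U $$ (i, j))) =
      (\<Sum>i<n. dq_inner (mat_star U $$ (j, i)) (mat_star U $$ (j, i)))"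
    using assms(2) by (simp add: mat_star_index dq_inner_cnj_self)
  also have "\<dots> = 1"
    using assms by (intro mat_unitary_row_sum mat_unitary_star)
  finally show ?thesis .
qed

lemma mat_unitary_sum_substochastic_le:
  assumes P: "mat_unitary m P" and "s \<le> m"
    and a: "\<And>i j. i \<le> j \<Longrightarrow> j < s \<Longrightarrow> a j \<le> a i" "\<And>i. i < s \<Longrightarrow> 0 \<le> a i"
    and b: "\<And>i j. i \<le> j \<Longrightarrow> j < s \<Longrightarrow> b j \<le> b i" "\<And>i. i < s \<Longrightarrow> 0 \<le> b i"
  shows "(\<Sum>i<s. \<Sum>j<s. a i * b j * dq_inner (P $$ (i, j)) (P $$ (i, j))) \<le> (\<Sum>i<s. a i * b i)"
proof (rule sum_substochastic_le)
  fix i assume "i < s"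
  have "(\<Sum>j<s. dq_inner (P $$ (i, j)) (P $$ (i, j))) \<le>
      (\<Sum>j<m. dq_inner (P $$ (i, j)) (P $$ (i, j)))"
    using \<open>s \<le> m\<close> by (intro sum_mono2 dq_inner_self_nonneg) auto
  then show "(\<Sum>j<s. dq_inner (P $$ (i, j)) (P $$ (i, j))) \<le> 1"
    using mat_unitary_row_sum[OF P, of i] \<open>i < s\<close> \<open>s \<le> m\<close> by simp
next
  fix j assume "j < s"
  have "(\<Sum>i<s. dq_inner (P $$ (i, j)) (P $$ (i, j))) \<le>
      (\<Sum>i<m. dq_inner (P $$ (i, j)) (P $$ (i, j)))"
    using \<open>s \<le> m\<close> by (intro sum_mono2 dq_inner_self_nonneg) auto
  then show "(\<Sum>i<s. dq_inner (P $$ (i, j)) (P $$ (i, j))) \<le> 1"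
    using mat_unitary_col_sum[OF P, of j] \<open>j < s\<close> \<open>s \<le> m\<close> by simp
qed (use a b dq_inner_self_nonneg in auto)

section \<open>Von Neumann's trace inequality\<close>

lemma diag_rect_carrier [simp]: "diag_rect m n x \<in> carrier_mat m n"
  by (simp add: diag_rect_def)

lemma diag_rect_index:
  "i < m \<Longrightarrow> j < n \<Longrightarrow> diag_rect m n x $$ (i, j) = (if i = j then dq_of_dual (x $ i) else 0)"
  by (simp add: diag_rect_def)

lemma mat_inner_diag_rect:
  "mat_inner (diag_rect m n x) Y = (\<Sum>i<min m n. dq_inner (dq_of_dual (x $ i)) (Y $$ (i, i)))"
proof -
  have "mat_inner (diag_rect m n x) Y =
      (\<Sum>i<m. \<Sum>j<n. if i = j then dq_inner (dq_of_dual (x $ i)) (Y $$ (i, i)) else 0)"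
    unfolding mat_inner_def carrier_matD[OF diag_rect_carrier]
    by (intro sum.cong refl) (simp add: diag_rect_index)
  also have "\<dots> = (\<Sum>i<m. if i < n then dq_inner (dq_of_dual (x $ i)) (Y $$ (i, i)) else 0)"
    by simp
  also have "\<dots> = (\<Sum>i<min m n. dq_inner (dq_of_dual (x $ i)) (Y $$ (i, i)))"
    by (intro sum.mono_neutral_cong_right) auto
  finally show ?thesis .
qed

lemma mult_diag_rect_mult_index:
  assumes P: "P \<in> carrier_mat m m" and Q: "Q \<in> carrier_mat n n" and "i < m" "j < n"
  shows "(P * diag_rect m n x * Q) $$ (i, j) =
    (\<Sum>k<min m n. P $$ (i, k) * dq_of_dual (x $ k) * Q $$ (k, j))"
proof -
  have PD: "(P * diag_rect m n x) $$ (i, k) = (if k < m then P $$ (i, k) * dq_of_dual (x $ k) else 0)"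
    if "k < n" for k
  proof -
    have "(P * diag_rect m n x) $$ (i, k) =
        (\<Sum>l<m. if l = k then P $$ (i, k) * dq_of_dual (x $ k) else 0)"
      using \<open>i < m\<close> that
      unfolding index_mult_mat_sum[OF P diag_rect_carrier \<open>i < m\<close> that]
      by (intro sum.cong refl) (simp add: diag_rect_index)
    then show ?thesis by simp
  qed
  have "(P * diag_rect m n x * Q) $$ (i, j) =
      (\<Sum>k<n. (P * diag_rect m n x) $$ (i, k) * Q $$ (k, j))"
    using assms by (intro index_mult_mat_sum[of _ m]) auto
  also have "\<dots> = (\<Sum>k<min m n. P $$ (i, k) * dq_of_dual (x $ k) * Q $$ (k, j))"
    by (intro sum.mono_neutral_cong_right) (auto simp: PD simp del: index_mult_mat(1))
  finally show ?thesis .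
qed

lemma singular_valuesE:
  assumes "singular_values A x" "A \<in> carrier_mat m n"
  obtains U V where "mat_unitary m U" "mat_unitary n V" "A = U * diag_rect m n x * mat_star V"
  using assms unfolding singular_values_def by auto

text \<open>Unitary invariance turns the inner product with \<open>A\<close> into one with its singular values.\<close>

lemma mat_inner_svd:
  assumes U: "mat_unitary m U" and V: "mat_unitary n V" and Y: "Y \<in> carrier_mat m n"
  shows "mat_inner (U * diag_rect m n x * mat_star V) Y =
    mat_inner (diag_rect m n x) (mat_star U * Y * V)"
proof -
  have UV: "U \<in> carrier_mat m m" "V \<in> carrier_mat n n"
    using U V by (auto simp: mat_unitary_def)
  have "mat_inner (U * diag_rect m n x * mat_star V) Y = mat_inner (U * diag_rect m n x) (Y * V)"
    using UV Y by (subst mat_inner_mult_right[of _ m n _ n]) auto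
  also have "\<dots> = mat_inner (diag_rect m n x) (mat_star U * (Y * V))"
    using UV Y by (subst mat_inner_mult_left[of _ m m _ n]) auto
  also have "mat_star U * (Y * V) = mat_star U * Y * V"
    using UV Y by (simp add: assoc_mult_mat[of _ m m _ n _ n])
  finally show ?thesis .
qed

lemma mat_inner_self_singular_values:
  assumes "A \<in> carrier_mat m n" "singular_values A x"
  shows "mat_inner A A = (\<Sum>i<min m n. x $ i * x $ i)"
proof -
  obtain U V where U: "mat_unitary m U" and V: "mat_unitary n V"
    and A: "A = U * diag_rect m n x * mat_star V"
    using singular_valuesE[OF assms(2,1)] .
  define D where "D = diag_rect m n x"
  have D: "D \<in> carrier_mat m n" by (simp add: D_def)
  have UV: "U \<in> carrier_mat m m" "mat_star U * U = 1\<^sub>m m"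
    "V \<in> carrier_mat n n" "mat_star V * V = 1\<^sub>m n"
    using U V by (auto simp: mat_unitary_def)
  have "mat_star U * (U * D * mat_star V) * V = (mat_star U * U) * D * (mat_star V * V)"
    using UV(1,3) D by (intro mult_mat_reassoc) auto
  then have "mat_inner A A = mat_inner D D"
    using UV D assms(1) mat_inner_svd[OF U V, of A x]
    by (simp add: A D_def left_mult_one_mat[of _ m n] right_mult_one_mat[of _ m n])
  also have "\<dots> = (\<Sum>i<min m n. x $ i * x $ i)"
    unfolding D_def mat_inner_diag_rect by (auto simp: diag_rect_index dq_inner_of_dual)
  finally show ?thesis .
qed

text \<open>
  The factor 2 is kept, instead of being cancelled, because the arithmetic-geometric mean bound for
  \<open>Re (P\<^sub>i\<^sub>j Q\<^sub>j\<^sub>i)\<close> yields one rearrangement sum for \<open>P\<close> and one for \<open>Q\<close>.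
\<close>

lemma von_neumann_trace_inequality:
  assumes A: "A \<in> carrier_mat m n" and B: "B \<in> carrier_mat m n"
    and a: "singular_values A a" and b: "singular_values B b"
  shows "2 * mat_inner A B \<le> 2 * (\<Sum>i<min m n. a $ i * b $ i)"
proof -
  define s where "s = min m n"
  have sv: "x $ j \<le> x $ i" "0 \<le> x $ j"
    if "singular_values X x" "X \<in> carrier_mat m n" "i \<le> j" "j < s" for X x i j
    using that by (auto simp: singular_values_def s_def)
  obtain U V where U: "mat_unitary m U" and V: "mat_unitary n V"
    and A_eq: "A = U * diag_rect m n a * mat_star V"
    using singular_valuesE[OF a A] .
  obtain W Z where W: "mat_unitary m W" and Z: "mat_unitary n Z"
    and B_eq: "B = W * diag_rect m n b * mat_star Z"
    using singular_valuesE[OF b B] .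
  define P where "P = mat_star U * W"
  define Q where "Q = mat_star Z * V"
  define R where "R = mat_star Q"
  have PQ: "mat_unitary m P" "mat_unitary n Q"
    unfolding P_def Q_def using U V W Z by (auto intro: mat_unitary_mult mat_unitary_star)
  have R: "mat_unitary n R"
    unfolding R_def using PQ(2) by (rule mat_unitary_star)
  have carr: "U \<in> carrier_mat m m" "W \<in> carrier_mat m m" "P \<in> carrier_mat m m"
    "V \<in> carrier_mat n n" "Z \<in> carrier_mat n n" "Q \<in> carrier_mat n n"
    using U V W Z PQ by (auto simp: mat_unitary_def)
  have bound: "(\<Sum>i<s. \<Sum>j<s. a $ i * b $ j * dq_inner (T $$ (i, j)) (T $$ (i, j))) \<le>
      (\<Sum>i<s. a $ i * b $ i)" if "mat_unitary k T" "s \<le> k" for k T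
  proof (rule mat_unitary_sum_substochastic_le[OF that])
    show "a $ j \<le> a $ i" "b $ j \<le> b $ i" if "i \<le> j" "j < s" for i j
      using that by (fact sv(1)[OF a A] sv(1)[OF b B])+
    show "0 \<le> a $ i" "0 \<le> b $ i" if "i < s" for i
      using that by (fact sv(2)[OF a A order_refl] sv(2)[OF b B order_refl])+
  qed
  have "mat_star U * B * V = P * diag_rect m n b * Q"
    unfolding B_eq P_def Q_def using carr by (intro mult_mat_reassoc) auto
  then have "mat_inner A B = mat_inner (diag_rect m n a) (P * diag_rect m n b * Q)"
    unfolding A_eq using mat_inner_svd[OF U V B] by simp
  also have "\<dots> = (\<Sum>i<s. \<Sum>j<s. a $ i * b $ j * dq_inner (P $$ (i, j)) (R $$ (i, j)))"
    unfolding mat_inner_diag_rect s_def using carr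
    by (auto intro!: sum.cong simp: mult_diag_rect_mult_index dq_inner_sum_right
        dq_inner_of_dual_mult R_def mat_star_index simp del: index_mult_mat(1))
  finally have "2 * mat_inner A B =
      (\<Sum>i<s. \<Sum>j<s. a $ i * b $ j * (2 * dq_inner (P $$ (i, j)) (R $$ (i, j))))"
    by (simp add: sum_distrib_left mult.left_commute)
  also have "\<dots> \<le> (\<Sum>i<s. \<Sum>j<s. a $ i * b $ j *
      (dq_inner (P $$ (i, j)) (P $$ (i, j)) + dq_inner (R $$ (i, j)) (R $$ (i, j))))"
    using sv(2)[OF a A order_refl] sv(2)[OF b B order_refl]
    by (intro sum_mono mult_left_mono two_dq_inner_le mult_nonneg_nonneg) auto
  also have "\<dots> = (\<Sum>i<s. \<Sum>j<s. a $ i * b $ j * dq_inner (P $$ (i, j)) (P $$ (i, j))) +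
      (\<Sum>i<s. \<Sum>j<s. a $ i * b $ j * dq_inner (R $$ (i, j)) (R $$ (i, j)))"
    by (simp add: distrib_left sum.distrib)
  also have "\<dots> \<le> (\<Sum>i<s. a $ i * b $ i) + (\<Sum>i<s. a $ i * b $ i)"
    using bound[OF PQ(1)] bound[OF R] by (intro add_mono) (simp_all add: s_def)
  finally show ?thesis
    by (simp only: s_def mult_2)
qed

section \<open>Comparing Frobenius norms\<close>

lemma frob_norm_appreciable:
  "mat_appreciable X \<Longrightarrow> frob_norm X = dual_sqrt (mat_inner X X)"
  by (simp add: frob_norm_def mat_inner_def dq_abs_power2)

lemma st_part_mat_inner_self_pos:
  assumes "mat_appreciable X"
  shows "0 < st_part (mat_inner X X)"
proof -
  obtain i j where ij: "i < dim_row X" "j < dim_col X" "st_part (X $$ (i, j)) \<noteq> 0"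
    using assms unfolding mat_appreciable_def
    by (metis (no_types, lifting) eq_matI index_map_mat index_zero_mat)
  let ?f = "\<lambda>i j. inner (st_part (X $$ (i, j))) (st_part (X $$ (i, j)))"
  have "0 < ?f i j"
    using ij by simp
  also have "\<dots> \<le> (\<Sum>j<dim_col X. ?f i j)"
    using ij by (intro member_le_sum) auto
  also have "\<dots> \<le> (\<Sum>i<dim_row X. \<Sum>j<dim_col X. ?f i j)"
    using ij by (intro member_le_sum[of _ _ "\<lambda>i. \<Sum>j<dim_col X. ?f i j"] sum_nonneg) auto
  also have "\<dots> = st_part (mat_inner X X)"
    by (simp add: mat_inner_def st_part_sum dq_inner_def)
  finally show ?thesis .
qed

text \<open>
  If \<open>X\<close> is appreciable, the square root is monotone; an infinitesimal norm of \<open>X\<close> lies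
  below every appreciable one, whatever the infinitesimal parts are.
\<close>

lemma frob_norm_mono:
  assumes "mat_appreciable Y" "mat_inner X X \<le> mat_inner Y Y"
  shows "frob_norm X \<le> frob_norm Y"
proof (cases "mat_appreciable X")
  case True
  with assms show ?thesis
    by (simp add: frob_norm_appreciable dual_sqrt_mono st_part_mat_inner_self_pos)
next
  case False
  then have "st_part (frob_norm X) = 0"
    by (simp add: frob_norm_def)
  moreover have "0 < st_part (frob_norm Y)"
    using assms(1) st_part_mat_inner_self_pos[of Y]
    by (simp add: frob_norm_appreciable dual_sqrt_def)
  ultimately show ?thesis
    by (simp add: dual_num_le_iff)
qed

lemma mat_inner_of_cols_self:
  "mat_inner (mat_of_cols (dim_vec x) [map_vec dq_of_dual x])
     (mat_of_cols (dim_vec x) [map_vec dq_of_dual x]) = (\<Sum>i<dim_vec x. x $ i * x $ i)"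
  by (simp add: mat_inner_def mat_of_cols_def dq_inner_of_dual)

theorem theorem5p1:
  fixes A B :: dq_mat and \<sigma>A \<sigma>B :: dual_vec and m n :: nat
  assumes "A \<in> carrier_mat m n" and "B \<in> carrier_mat m n"
    and "singular_values A \<sigma>A" and "singular_values B \<sigma>B"
    and "mat_appreciable (A - B)"
  shows "dual_vec_norm (\<sigma>A - \<sigma>B) \<le> frob_norm (A - B)"
proof -
  let ?s = "min m n"
  have dims: "dim_vec \<sigma>A = ?s" "dim_vec \<sigma>B = ?s"
    using assms(1-4) by (auto simp: singular_values_def)
  have "(\<Sum>i<?s. (\<sigma>A - \<sigma>B) $ i * (\<sigma>A - \<sigma>B) $ i) =
      (\<Sum>i<?s. \<sigma>A $ i * \<sigma>A $ i) + (\<Sum>i<?s. \<sigma>B $ i * \<sigma>B $ i) - 2 * (\<Sum>i<?s. \<sigma>A $ i * \<sigma>B $ i)"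
    using dims
    by (simp add: sum.distrib[symmetric] sum_subtractf[symmetric] sum_distrib_left algebra_simps)
  also have "\<dots> \<le> mat_inner A A + mat_inner B B - 2 * mat_inner A B"
    using von_neumann_trace_inequality[OF assms(1-4)]
    by (simp add: mat_inner_self_singular_values[OF assms(1,3)]
        mat_inner_self_singular_values[OF assms(2,4)])
  also have "\<dots> = mat_inner (A - B) (A - B)"
    using mat_inner_diff_self[OF assms(1,2)] by simp
  finally show ?thesis
    unfolding dual_vec_norm_def
    by (intro frob_norm_mono assms(5)) (simp only: mat_inner_of_cols_self, simp add: dims)
qed

end
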